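(* Let $G$ be a finite group of order $N$ acting unitarily on the $d$-dimensional real inner product space $\mathcal{V}$. Assume that for some $S\subset[N]\times[p]$, $|S|=m$, and $\mathbf{w}=(w_1,\dots,w_p)\in\mathcal{V}^p$, the map $\widehat{\Phi}_{\mathbf{w},S}:\widehat{\mathcal{V}}\to\mathbb{R}^m$ is bi-Lipschitz on the quotient space $\widehat{\mathcal{V}}=\mathcal{V}/G$, with (upper) Lipschitz constant $b=\mathrm{Lip}(\widehat{\Phi}_{\mathbf{w},S})$ and lower Lipschitz constant $a>0$. 1. For every Lipschitz map $F:\widehat{\mathcal{V}}\to H$ into a real Hilbert space $H$ there exists a Lipschitz map $T:\mathbb{R}^m\to H$ such that $F=T\circ\Phi_{\mathbf{w},S}$ (i.e. $F([x])=T(\Phi_{\mathbf{w},S}(x))$ for all $x\in\mathcal{V}$) and $\mathrm{Lip}(T)\le\frac1a\mathrm{Lip}(F)$. 2. Conversely, for any Lipschitz map $T:\mathbb{R}^m\to H$ into a real Hilbert space $H$, the map $F=T\circ\Phi_{\mathbf{w},S}$ (regarded as a map on $\widehat{\mathcal{V}}$, $F([x])=T(\Phi_{\mathbf{w},S}(x))$) is Lipschitz with $\mathrm{Lip}(F)\le b\,\mathrm{Lip}(T)$.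
   Context: $(\mathcal{V},\langle\cdot,\cdot\rangle)$ is a real inner product space of finite dimension $d\ge 2$, and $G$ ($|G|=N$) acts unitarily: $g\mapsto U_g$ is a homomorphism into the group of linear isometries of $\mathcal{V}$. The orbit of $x$ is $[x]=\{U_gx:g\in G\}$, $\widehat{\mathcal{V}}=\mathcal{V}/G$ is the set of orbits, with metric $\mathbf{d}([x],[y])=\min_{g\in G}\|x-U_gy\|$. For $n\in\mathbb{N}$, $[n]=\{1,\dots,n\}$. For $i\in[p]$ and $j\in[N]$, $\Phi_{w_i,j}(x)$ is the $j$-th coordinate of the vector obtained by sorting the $N$ numbers $(\langle U_gw_i,x\rangle)_{g\in G}$ (with repetitions) in decreasing order. With $S_i=\{k\in[N]:(k,i)\in S\}$, the coorbit embedding is $$\Phi_{\mathbf{w},S}:\mathcal{V}\to\mathbb{R}^m,\qquad \Phi_{\mathbf{w},S}(x)=\big[\{\Phi_{w_1,j}(x)\}_{j\in S_1},\dots,\{\Phi_{w_p,j}(x)\}_{j\in S_p}\big].$$ It is $G$-invariant, and $\widehat{\Phi}_{\mathbf{w},S}([x])=\Phi_{\mathbf{w},S}(x)$ is the induced map on $\widehat{\mathcal{V}}$. $\mathbb{R}^m$ has the Euclidean norm. Lower Lipschitz constant $a$ means $a\,\mathbf{d}([x],[y])\le\|\Phi_{\mathbf{w},S}(x)-\Phi_{\mathbf{w},S}(y)\|$ for all $x,y$. $\mathrm{Lip}(f)$ denotes the Lipschitz constant (least upper Lipschitz bound) of $f$; on $\widehat{\mathcal{V}}$ it is taken with respect to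 $\mathbf{d}$. *)

theory Defs
  imports "HOL-Analysis.Analysis" "HOL-Algebra.Group_Action" "HOL-Library.Multiset"
begin

locale unitary_action = group_action G UNIV U
  for G (structure) and U :: "'g \<Rightarrow> 'a::euclidean_space \<Rightarrow> 'a" +
  assumes finite_group: "finite (carrier G)"
    and isometry: "g \<in> carrier G \<Longrightarrow> orthogonal_transformation (U g)"

text \<open>The distance of \<open>[x]\<close> and \<open>[y]\<close> is \<open>min\<^sub>g \<parallel>x - U\<^sub>g y\<parallel>\<close>, for any representatives \<open>x\<close> and \<open>y\<close>
  (lemma \<open>orbit_dist_orbit\<close> below). It is set to 0 on sets that are not orbits only because the
  locale \<^locale>\<open>Metric_space\<close> asks for symmetry and nonnegativity on the whole type.\<close>

definition orbit_dist :: "('g, 'z) monoid_scheme \<Rightarrow> ('g \<Rightarrow> 'a::euclidean_space \<Rightarrow> 'a) \<Rightarrow>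
    'a set \<Rightarrow> 'a set \<Rightarrow> real" where
  "orbit_dist G U X Y =
     (if X \<in> orbits G UNIV U \<and> Y \<in> orbits G UNIV U
      then THE r. \<exists>x y. X = orbit G U x \<and> Y = orbit G U y \<and>
             r = Min ((\<lambda>g. norm (x - U g y)) ` carrier G)
      else 0)"

definition quotient_metric :: "('g, 'z) monoid_scheme \<Rightarrow> ('g \<Rightarrow> 'a::euclidean_space \<Rightarrow> 'a) \<Rightarrow>
    'a set metric" where
  "quotient_metric G U = metric (orbits G UNIV U, orbit_dist G U)"

definition induced_map :: "('g, 'z) monoid_scheme \<Rightarrow> ('g \<Rightarrow> 'a \<Rightarrow> 'a) \<Rightarrow> ('a \<Rightarrow> 'b) \<Rightarrow> 'a set \<Rightarrow> 'b" where
  "induced_map G U f X = (THE v. \<exists>x. X = orbit G U x \<and> v = f x)"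

text \<open>The index \<open>j\<close> is 1-based; the result is unspecified unless \<open>1 \<le> j \<le> order G\<close>.\<close>

definition coorbit :: "('g, 'z) monoid_scheme \<Rightarrow> ('g \<Rightarrow> 'a::euclidean_space \<Rightarrow> 'a) \<Rightarrow>
    'a \<Rightarrow> nat \<Rightarrow> 'a \<Rightarrow> real" where
  "coorbit G U w j x =
     rev (sorted_list_of_multiset (image_mset (\<lambda>g. U g w \<bullet> x) (mset_set (carrier G)))) ! (j - 1)"

text \<open>The map \<open>e\<close> enumerates the index set \<open>S\<close>: the coordinate \<open>c\<close> of the embedding is the
  \<open>j\<close>-th sorted coefficient of the window \<open>w i\<close>, where \<open>e c = (j, i)\<close>.\<close>

definition coorbit_embedding :: "('g, 'z) monoid_scheme \<Rightarrow> ('g \<Rightarrow> 'a::euclidean_space \<Rightarrow> 'a) \<Rightarrow>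
    (nat \<Rightarrow> 'a) \<Rightarrow> ('m::finite \<Rightarrow> nat \<times> nat) \<Rightarrow> 'a \<Rightarrow> real ^ 'm" where
  "coorbit_embedding G U w e x = (\<chi> c. case e c of (j, i) \<Rightarrow> coorbit G U (w i) j x)"

definition Lip :: "'a metric \<Rightarrow> 'b metric \<Rightarrow> ('a \<Rightarrow> 'b) \<Rightarrow> real" where
  "Lip m1 m2 f =
     Inf {L. 0 \<le> L \<and> (\<forall>x \<in> mspace m1. \<forall>y \<in> mspace m1. mdist m2 (f x) (f y) \<le> L * mdist m1 x y)}"

context unitary_action
begin

lemma grp: "group G"
  using group_hom group_hom.axioms(1) by auto

lemma orbit_self: "x \<in> orbit G U x"
  by (rule orbit_refl) simp

lemma action_inverse: "g \<in> carrier G \<Longrightarrow> U (inv g) (U g x) = x"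
  using orbit_sym_aux by blast

lemma action_norm: "g \<in> carrier G \<Longrightarrow> norm (U g x - U g y) = norm (x - y)"
  using isometry[of g] linear_diff[of "U g" x y] by (metis orthogonal_transformation)

lemma action_orbit: "g \<in> carrier G \<Longrightarrow> orbit G U (U g x) = orbit G U x"
proof -
  assume g: "g \<in> carrier G"
  interpret group G by (rule grp)
  show ?thesis
  proof (rule Set.set_eqI)
    fix z
    have "z \<in> orbit G U (U g x)" if z: "z \<in> orbit G U x"
    proof -
      obtain h where h: "h \<in> carrier G" "z = U h x" using z by (auto simp: orbit_def)
      then have "z = U (h \<otimes> inv g) (U g x)"
        using g by (simp add: composition_rule action_inverse)
      then show ?thesis unfolding orbit_def using g h by blast
    qed
    moreover have "z \<in> orbit G U x" if z: "z \<in> orbit G U (U g x)"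
    proof -
      obtain h where h: "h \<in> carrier G" "z = U h (U g x)" using z by (auto simp: orbit_def)
      then have "z = U (h \<otimes> g) x" using g by (simp add: composition_rule)
      then show ?thesis unfolding orbit_def using g h by blast
    qed
    ultimately show "z \<in> orbit G U (U g x) \<longleftrightarrow> z \<in> orbit G U x" by blast
  qed
qed

lemma orbit_eq_iff: "orbit G U x = orbit G U y \<longleftrightarrow> (\<exists>g \<in> carrier G. x = U g y)"
proof
  assume "orbit G U x = orbit G U y"
  then have "x \<in> orbit G U y" using orbit_self by blast
  then show "\<exists>g \<in> carrier G. x = U g y" by (auto simp: orbit_def)
qed (auto simp: action_orbit)

lemma carrier_nonempty: "carrier G \<noteq> {}"
  using group.is_monoid[OF grp] monoid.one_closed by blast

lemma norm_set_eq:
  "(\<lambda>g. norm (x - U g y)) ` carrier G = {norm (u - v) | u v. u \<in> orbit G U x \<and> v \<in> orbit G U y}"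
    (is "?A = ?B")
proof
  show "?A \<subseteq> ?B" using orbit_self[of x] by (auto simp: orbit_def[of G U y])
  show "?B \<subseteq> ?A"
  proof
    interpret group G by (rule grp)
    fix r assume "r \<in> ?B"
    then obtain g h where gh: "g \<in> carrier G" "h \<in> carrier G" "r = norm (U g x - U h y)"
      by (auto simp: orbit_def)
    then have "r = norm (U (inv g) (U g x) - U (inv g) (U h y))"
      by (simp add: action_norm)
    then have "r = norm (x - U (inv g \<otimes> h) y)"
      using gh by (simp add: composition_rule action_inverse)
    then show "r \<in> ?A" using gh by blast
  qed
qed

lemma orbit_dist_orbit:
  "orbit_dist G U (orbit G U x) (orbit G U y) = Min ((\<lambda>g. norm (x - U g y)) ` carrier G)"
proof -
  have mem: "orbit G U z \<in> orbits G UNIV U" for z by (auto simp: orbits_def)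
  have "(THE r. \<exists>x' y'. orbit G U x = orbit G U x' \<and> orbit G U y = orbit G U y' \<and>
           r = Min ((\<lambda>g. norm (x' - U g y')) ` carrier G))
        = Min ((\<lambda>g. norm (x - U g y)) ` carrier G)"
    unfolding norm_set_eq by (rule the_equality) auto
  then show ?thesis unfolding orbit_dist_def using mem by simp
qed

lemma orbit_dist_le: "g \<in> carrier G \<Longrightarrow> orbit_dist G U (orbit G U x) (orbit G U y) \<le> norm (x - U g y)"
  unfolding orbit_dist_orbit using finite_group by simp

lemma orbit_dist_attained:
  obtains g where "g \<in> carrier G" "orbit_dist G U (orbit G U x) (orbit G U y) = norm (x - U g y)"
proof -
  have "Min ((\<lambda>g. norm (x - U g y)) ` carrier G) \<in> (\<lambda>g. norm (x - U g y)) ` carrier G"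
    using finite_group carrier_nonempty by (intro Min_in) auto
  then show ?thesis using that orbit_dist_orbit by auto
qed

lemma Metric_space_orbits: "Metric_space (orbits G UNIV U) (orbit_dist G U)"
proof
  fix X Y
  show "0 \<le> orbit_dist G U X Y"
  proof (cases "X \<in> orbits G UNIV U \<and> Y \<in> orbits G UNIV U")
    case True
    then obtain x y where "X = orbit G U x" "Y = orbit G U y" by (auto simp: orbits_def)
    then show ?thesis using orbit_dist_attained[of x y] by (metis norm_ge_zero)
  next
    case False
    then show ?thesis by (auto simp: orbit_dist_def)
  qed
  show "orbit_dist G U X Y = orbit_dist G U Y X"
  proof (cases "X \<in> orbits G UNIV U \<and> Y \<in> orbits G UNIV U")
    case True
    then obtain x y where xy: "X = orbit G U x" "Y = orbit G U y" by (auto simp: orbits_def)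
    have "{norm (u - v) | u v. u \<in> orbit G U x \<and> v \<in> orbit G U y}
        = {norm (u - v) | u v. u \<in> orbit G U y \<and> v \<in> orbit G U x}"
      using norm_minus_commute by blast
    then show ?thesis unfolding xy orbit_dist_orbit norm_set_eq by simp
  next
    case False
    then show ?thesis by (auto simp: orbit_dist_def)
  qed
next
  fix X Y assume "X \<in> orbits G UNIV U" "Y \<in> orbits G UNIV U"
  then obtain x y where xy: "X = orbit G U x" "Y = orbit G U y" by (auto simp: orbits_def)
  show "orbit_dist G U X Y = 0 \<longleftrightarrow> X = Y"
  proof
    assume 0: "orbit_dist G U X Y = 0"
    obtain g where "g \<in> carrier G" "orbit_dist G U X Y = norm (x - U g y)"
      using orbit_dist_attained[of x y] xy by metis
    then show "X = Y" using 0 xy orbit_eq_iff by auto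
  next
    assume "X = Y"
    then obtain g where g: "g \<in> carrier G" "x = U g y" using xy orbit_eq_iff by auto
    then have "orbit_dist G U X Y \<le> 0" using orbit_dist_le[of g x y] xy by simp
    moreover obtain h where "orbit_dist G U X Y = norm (x - U h y)"
      using orbit_dist_attained[of x y] xy by metis
    ultimately show "orbit_dist G U X Y = 0" by simp
  qed
next
  fix X Y Z assume "X \<in> orbits G UNIV U" "Y \<in> orbits G UNIV U" "Z \<in> orbits G UNIV U"
  then obtain x y z where xyz: "X = orbit G U x" "Y = orbit G U y" "Z = orbit G U z"
    by (auto simp: orbits_def)
  interpret group G by (rule grp)
  obtain g where g: "g \<in> carrier G" "orbit_dist G U X Y = norm (x - U g y)"
    using orbit_dist_attained[of x y] xyz by metis
  obtain h where h: "h \<in> carrier G" "orbit_dist G U Y Z = norm (y - U h z)"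
    using orbit_dist_attained[of y z] xyz by metis
  have "orbit_dist G U X Z \<le> norm (x - U (g \<otimes> h) z)"
    using orbit_dist_le[of "g \<otimes> h" x z] g h xyz by simp
  also have "\<dots> = norm ((x - U g y) + (U g y - U g (U h z)))"
    using g h by (simp add: composition_rule)
  also have "\<dots> \<le> norm (x - U g y) + norm (U g y - U g (U h z))"
    by (rule norm_triangle_ineq)
  finally show "orbit_dist G U X Z \<le> orbit_dist G U X Y + orbit_dist G U Y Z"
    using g h by (simp add: action_norm)
qed

lemma mspace_quotient_metric: "mspace (quotient_metric G U) = orbits G UNIV U"
  and mdist_quotient_metric: "mdist (quotient_metric G U) = orbit_dist G U"
  unfolding quotient_metric_def
  by (simp_all add: Metric_space_orbits Metric_space.mspace_metric Metric_space.mdist_metric)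

lemma induced_map_orbit:
  assumes "\<And>g x. g \<in> carrier G \<Longrightarrow> f (U g x) = f x"
  shows "induced_map G U f (orbit G U x) = f x"
  unfolding induced_map_def
proof (rule the_equality)
  show "\<exists>y. orbit G U x = orbit G U y \<and> f x = f y" by blast
qed (auto simp: orbit_eq_iff assms)

lemma coorbit_invariant:
  assumes g: "g \<in> carrier G"
  shows "coorbit G U w j (U g x) = coorbit G U w j x"
proof -
  interpret group G by (rule grp)
  have bij: "bij_betw (\<lambda>h. g \<otimes> h) (carrier G) (carrier G)"
    by (rule bij_betw_byWitness[where f' = "\<lambda>h. inv g \<otimes> h"])
       (use g in \<open>auto simp: m_assoc[symmetric]\<close>)
  then have "mset_set (carrier G) = image_mset (\<lambda>h. g \<otimes> h) (mset_set (carrier G))"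
    by (simp add: bij_betw_def image_mset_mset_set)
  then have "image_mset (\<lambda>h. U h w \<bullet> U g x) (mset_set (carrier G)) =
      image_mset (\<lambda>h. U h w \<bullet> U g x) (image_mset (\<lambda>h. g \<otimes> h) (mset_set (carrier G)))"
    by simp
  also have "\<dots> = image_mset (\<lambda>h. U h w \<bullet> x) (mset_set (carrier G))"
    unfolding multiset.map_comp
    by (rule image_mset_cong)
       (use g isometry[OF g] finite_group in
         \<open>auto simp: composition_rule orthogonal_transformation_def\<close>)
  finally show ?thesis by (simp add: coorbit_def)
qed

lemma coorbit_embedding_invariant:
  "g \<in> carrier G \<Longrightarrow> coorbit_embedding G U w e (U g x) = coorbit_embedding G U w e x"
  by (simp add: coorbit_embedding_def coorbit_invariant split: prod.split)

lemma induced_coorbit_embedding: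
  "induced_map G U (coorbit_embedding G U w e) (orbit G U x) = coorbit_embedding G U w e x"
  by (rule induced_map_orbit) (rule coorbit_embedding_invariant)

end

end

theory Submission
  imports Defs
begin

text \<open>
  The second half holds because Lipschitz constants are submultiplicative under composition.

  For the first half, the lower Lipschitz bound says that a map \<open>F\<close> on orbits, read as a map on
  the image of the embedding \<open>\<Phi>\<close>, is well defined and \<open>Lip F / a\<close>-Lipschitz there:
  \<open>\<parallel>F[x] - F[y]\<parallel> \<le> Lip F \<cdot> d([x],[y]) \<le> (Lip F / a) \<parallel>\<Phi> x - \<Phi> y\<parallel>\<close>. It remains to extend it from
  that image, a subset of \<open>\<real>\<^sup>m\<close> of any shape, to the whole space with the same constant. This is
  Kirszbraun's theorem, proved here for maps from a subset of any real inner product space into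
  any real Hilbert space (theorem \<open>kirszbraun\<close>).

  By Zorn's lemma it suffices to extend a map to one new point \<open>x0\<close>, that is, to find a point common
  to the balls around the values \<open>v i\<close> with radii \<open>L \<parallel>x0 - x i\<parallel>\<close>. For finitely many balls
  (\<open>kirszbraun_finite\<close>) the point comes out of a compactness argument: minimising
  \<open>max\<^sub>i (\<parallel>y - v i\<parallel>\<^sup>2 - L\<^sup>2 \<parallel>x0 - x i\<parallel>\<^sup>2)\<close> over \<open>y\<close> has a concave dual problem over the simplex of
  weights; a maximiser of the dual gives \<open>y\<close>, and the dual value is at most 0 because, for
  weights \<open>u\<close>, the variance \<open>\<Sum>\<^sub>i u\<^sub>i \<parallel>v i\<parallel>\<^sup>2 - \<parallel>\<Sum>\<^sub>i u\<^sub>i v i\<parallel>\<^sup>2\<close> depends on pairwise distances only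
  and is therefore at most \<open>L\<^sup>2\<close> times the variance of the points \<open>x i - x0\<close>, which in turn is at
  most \<open>\<Sum>\<^sub>i u\<^sub>i \<parallel>x i - x0\<parallel>\<^sup>2\<close>.
  Infinitely many balls are handled by the finite intersection property of closed convex
  sets, one of them bounded, in a Hilbert space (\<open>hilbert_closed_convex_fip\<close>).
\<close>

section \<open>Common points of finitely many balls\<close>

text \<open>The variance of a weighted family is determined by the pairwise distances; through this
  identity a Lipschitz bound on pairs turns into a bound between variances.\<close>
lemma weighted_sum_pairwise_dist:
  fixes f :: "'i \<Rightarrow> 'b::real_inner"
  assumes one: "sum u A = 1"
  shows "(\<Sum>i\<in>A. \<Sum>j\<in>A. u i * u j * (norm (f i - f j))\<^sup>2)
       = 2 * ((\<Sum>i\<in>A. u i * (norm (f i))\<^sup>2) - (norm (\<Sum>i\<in>A. u i *\<^sub>R f i))\<^sup>2)"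
proof -
  have cross: "(norm (\<Sum>i\<in>A. u i *\<^sub>R f i))\<^sup>2 = (\<Sum>i\<in>A. \<Sum>j\<in>A. u i * u j * (f i \<bullet> f j))"
    by (simp add: power2_norm_eq_inner inner_sum_left inner_sum_right sum_distrib_left
        mult_ac inner_commute)
  have left: "(\<Sum>i\<in>A. \<Sum>j\<in>A. u i * u j * (norm (f i))\<^sup>2) = (\<Sum>i\<in>A. u i * (norm (f i))\<^sup>2)"
  proof (rule sum.cong[OF refl])
    fix i
    have "(\<Sum>j\<in>A. u i * u j * (norm (f i))\<^sup>2) = (u i * (norm (f i))\<^sup>2) * sum u A"
      unfolding sum_distrib_left by (simp add: mult_ac)
    then show "(\<Sum>j\<in>A. u i * u j * (norm (f i))\<^sup>2) = u i * (norm (f i))\<^sup>2"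
      using one by simp
  qed
  have right: "(\<Sum>i\<in>A. \<Sum>j\<in>A. u i * u j * (norm (f j))\<^sup>2) = (\<Sum>i\<in>A. u i * (norm (f i))\<^sup>2)"
    by (subst sum.swap, subst left[symmetric]) (simp add: mult_ac)
  have square: "(norm (f i - f j))\<^sup>2 = (norm (f i))\<^sup>2 + (norm (f j))\<^sup>2 - 2 * (f i \<bullet> f j)" for i j
    by (simp add: power2_norm_eq_inner inner_diff_left inner_diff_right inner_commute)
  have "u i * u j * (norm (f i - f j))\<^sup>2 = u i * u j * (norm (f i))\<^sup>2
      + u i * u j * (norm (f j))\<^sup>2 - 2 * (u i * u j * (f i \<bullet> f j))" for i j
    by (simp only: square) (simp add: algebra_simps)
  then have "(\<Sum>i\<in>A. \<Sum>j\<in>A. u i * u j * (norm (f i - f j))\<^sup>2)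
      = (\<Sum>i\<in>A. \<Sum>j\<in>A. u i * u j * (norm (f i))\<^sup>2)
      + (\<Sum>i\<in>A. \<Sum>j\<in>A. u i * u j * (norm (f j))\<^sup>2)
      - 2 * (\<Sum>i\<in>A. \<Sum>j\<in>A. u i * u j * (f i \<bullet> f j))"
    by (simp only: sum.distrib sum_subtractf sum_distrib_left)
  then show ?thesis unfolding left right cross by simp
qed

lemma nonpos_if_le_small_multiples:
  fixes a b :: real
  assumes "\<And>t. 0 < t \<Longrightarrow> t \<le> 1 \<Longrightarrow> a \<le> t * b"
  shows "a \<le> 0"
proof (rule tendsto_lowerbound)
  show "((\<lambda>t. t * b) \<longlongrightarrow> 0) (at_right 0)"
    by (auto intro!: tendsto_eq_intros)
  show "\<forall>\<^sub>F t in at_right 0. a \<le> t * b"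
    using assms unfolding eventually_at_right_field by (intro exI[of _ 1]) auto
qed simp

text \<open>Write \<open>s i = \<parallel>v i\<parallel>\<^sup>2 - L\<^sup>2 \<parallel>x i - x0\<parallel>\<^sup>2\<close>. The function \<open>\<phi>\<close> below is the dual objective
  \<open>\<Sum>\<^sub>i u\<^sub>i s i - \<parallel>\<Sum>\<^sub>i u\<^sub>i v i\<parallel>\<^sup>2\<close> as a function of the point of the convex hull that the weights \<open>u\<close>
  represent, rather than of \<open>u\<close>. First-order optimality at a maximiser with \<open>v\<close>-component \<open>y\<close>
  reads \<open>\<parallel>y - v i\<parallel>\<^sup>2 - L\<^sup>2 \<parallel>x i - x0\<parallel>\<^sup>2 \<le> max \<phi>\<close>, and \<open>\<phi> \<le> 0\<close> follows by comparing variances.\<close>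
lemma kirszbraun_finite:
  fixes x :: "'i \<Rightarrow> 'x::real_inner" and v :: "'i \<Rightarrow> 'h::real_inner"
  assumes fin: "finite I" and "L \<ge> 0"
    and lip: "\<And>i j. i \<in> I \<Longrightarrow> j \<in> I \<Longrightarrow> norm (v i - v j) \<le> L * norm (x i - x j)"
  shows "\<exists>y. \<forall>i\<in>I. norm (y - v i) \<le> L * norm (x0 - x i)"
proof (cases "I = {}")
  case False
  \<comment> \<open>Carrying \<open>x i - x0\<close> along lets the variance of these points be taken with the same
    weights as that of the values \<open>v i\<close>.\<close>
  define P where "P i = (x i - x0, v i, (norm (v i))\<^sup>2 - L\<^sup>2 * (norm (x i - x0))\<^sup>2)" for i
  define \<phi> :: "'x \<times> 'h \<times> real \<Rightarrow> real" where "\<phi> q = snd (snd q) - (norm (fst (snd q)))\<^sup>2" for q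
  define K where "K = convex hull (P ` I)"
  have "compact K" "K \<noteq> {}"
    using fin False by (auto simp: K_def finite_imp_compact_convex_hull)
  moreover have "continuous_on K \<phi>"
    unfolding \<phi>_def by (intro continuous_intros)
  ultimately obtain q where q: "q \<in> K" and max: "\<And>r. r \<in> K \<Longrightarrow> \<phi> r \<le> \<phi> q"
    using continuous_attains_sup by metis
  have \<phi>q: "\<phi> q \<le> 0"
  proof -
    obtain u where u: "\<forall>r\<in>P ` I. 0 \<le> u r" "sum u (P ` I) = 1" "(\<Sum>r\<in>P ` I. u r *\<^sub>R r) = q"
      using q fin unfolding K_def by (auto simp: convex_hull_finite)
    let ?A = "P ` I"
    have q1: "fst (snd q) = (\<Sum>r\<in>?A. u r *\<^sub>R fst (snd r))"
      and q2: "snd (snd q) = (\<Sum>r\<in>?A. u r * snd (snd r))"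
      unfolding u(3)[symmetric] by (simp_all add: fst_sum snd_sum)
    have "(\<Sum>i\<in>?A. \<Sum>j\<in>?A. u i * u j * (norm (fst (snd i) - fst (snd j)))\<^sup>2)
        \<le> (\<Sum>i\<in>?A. \<Sum>j\<in>?A. u i * u j * (L\<^sup>2 * (norm (fst i - fst j))\<^sup>2))"
    proof (intro sum_mono mult_left_mono)
      fix r s assume rs: "r \<in> ?A" "s \<in> ?A"
      then have "norm (fst (snd r) - fst (snd s)) \<le> L * norm (fst r - fst s)"
        using lip by (auto simp: P_def)
      then have "(norm (fst (snd r) - fst (snd s)))\<^sup>2 \<le> (L * norm (fst r - fst s))\<^sup>2"
        by (intro power_mono) auto
      then show "(norm (fst (snd r) - fst (snd s)))\<^sup>2 \<le> L\<^sup>2 * (norm (fst r - fst s))\<^sup>2"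
        by (simp add: power_mult_distrib)
      show "0 \<le> u r * u s"
        using bspec[OF u(1) rs(1)] bspec[OF u(1) rs(2)] by simp
    qed
    also have "\<dots> = L\<^sup>2 * (\<Sum>i\<in>?A. \<Sum>j\<in>?A. u i * u j * (norm (fst i - fst j))\<^sup>2)"
      by (simp add: sum_distrib_left mult_ac)
    also have "\<dots> = L\<^sup>2 * (2 * ((\<Sum>i\<in>?A. u i * (norm (fst i))\<^sup>2) - (norm (\<Sum>i\<in>?A. u i *\<^sub>R fst i))\<^sup>2))"
      by (simp only: weighted_sum_pairwise_dist[OF u(2)])
    also have "\<dots> \<le> L\<^sup>2 * (2 * (\<Sum>i\<in>?A. u i * (norm (fst i))\<^sup>2))"
      by (intro mult_left_mono) auto
    finally have "(\<Sum>i\<in>?A. u i * (norm (fst (snd i)))\<^sup>2) - (norm (\<Sum>i\<in>?A. u i *\<^sub>R fst (snd i)))\<^sup>2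
        \<le> L\<^sup>2 * (\<Sum>i\<in>?A. u i * (norm (fst i))\<^sup>2)"
      unfolding weighted_sum_pairwise_dist[OF u(2)] by simp
    moreover have "snd (snd q) = (\<Sum>i\<in>?A. u i * (norm (fst (snd i)))\<^sup>2) - L\<^sup>2 * (\<Sum>i\<in>?A. u i * (norm (fst i))\<^sup>2)"
      unfolding q2 sum_distrib_left sum_subtractf[symmetric]
      by (rule sum.cong) (auto simp: P_def algebra_simps)
    ultimately show ?thesis unfolding \<phi>_def q1 by simp
  qed
  have "norm (fst (snd q) - v i) \<le> L * norm (x0 - x i)" if i: "i \<in> I" for i
  proof -
    let ?y = "fst (snd q)" and ?s = "(norm (v i))\<^sup>2 - L\<^sup>2 * (norm (x i - x0))\<^sup>2"
    \<comment> \<open>The one-sided derivative of \<open>\<phi>\<close> at \<open>q\<close> towards \<open>P i\<close> is nonpositive.\<close>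
    have "(?s - snd (snd q)) - 2 * (?y \<bullet> (v i - ?y)) \<le> 0"
    proof (rule nonpos_if_le_small_multiples)
      fix t :: real assume t: "0 < t" "t \<le> 1"
      have "(1 - t) *\<^sub>R q + t *\<^sub>R P i \<in> K"
        using q i t unfolding K_def by (intro convexD[OF convex_convex_hull]) (auto intro: hull_inc)
      from max[OF this]
      have "(1 - t) * snd (snd q) + t * ?s - (norm ((1 - t) *\<^sub>R ?y + t *\<^sub>R v i))\<^sup>2
          \<le> snd (snd q) - (norm ?y)\<^sup>2"
        by (simp add: \<phi>_def P_def)
      moreover have "(1 - t) *\<^sub>R ?y + t *\<^sub>R v i = ?y + t *\<^sub>R (v i - ?y)"
        by (simp add: algebra_simps)
      moreover have "(norm (?y + t *\<^sub>R (v i - ?y)))\<^sup>2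
          = (norm ?y)\<^sup>2 + t * (2 * (?y \<bullet> (v i - ?y))) + t * (t * (norm (v i - ?y))\<^sup>2)"
        unfolding power2_norm_eq_inner
        by (simp add: inner_add_left inner_add_right inner_diff_left inner_diff_right
              inner_commute algebra_simps)
      ultimately have "t * ((?s - snd (snd q)) - 2 * (?y \<bullet> (v i - ?y))) \<le> t * (t * (norm (v i - ?y))\<^sup>2)"
        by (simp add: algebra_simps)
      then show "(?s - snd (snd q)) - 2 * (?y \<bullet> (v i - ?y)) \<le> t * (norm (v i - ?y))\<^sup>2"
        using t by simp
    qed
    then have "(norm (?y - v i))\<^sup>2 - L\<^sup>2 * (norm (x i - x0))\<^sup>2 \<le> \<phi> q"
      unfolding \<phi>_def power2_norm_eq_inner
      by (simp add: inner_diff_left inner_diff_right inner_commute)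
    then have "(norm (?y - v i))\<^sup>2 \<le> (L * norm (x0 - x i))\<^sup>2"
      using \<phi>q by (simp add: power_mult_distrib norm_minus_commute)
    then show ?thesis
      by (rule power2_le_imp_le) (use \<open>L \<ge> 0\<close> in simp)
  qed
  then show ?thesis by blast
qed simp

section \<open>Finite intersection property of closed convex sets\<close>

text \<open>This is weak compactness of bounded closed convex sets, obtained from completeness alone.
  Let \<open>s\<close> be the supremum, over finite subfamilies \<open>J\<close>, of the least squared norm on \<open>\<Inter>J\<close>; it is
  finite because a bounded set \<open>B\<close> may be added to every \<open>J\<close>. The points of \<open>\<Inter>J\<close> of squared norm at
  most \<open>s + \<epsilon>\<close> form a nonempty closed set, and by the parallelogram law this set is small if
  \<open>\<epsilon>\<close> is small and \<open>J\<close> is nearly optimal. Cantor's intersection theorem for these sets gives a common point.\<close>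
lemma hilbert_closed_convex_fip:
  fixes F :: "'h::{real_inner, complete_space} set set"
  assumes closed: "\<And>C. C \<in> F \<Longrightarrow> closed C" and conv: "\<And>C. C \<in> F \<Longrightarrow> convex C"
    and bdd: "B \<in> F" "bounded B"
    and fip: "\<And>J. finite J \<Longrightarrow> J \<subseteq> F \<Longrightarrow> \<Inter>J \<noteq> {}"
  shows "\<Inter>F \<noteq> {}"
proof -
  define A where "A = {r. \<exists>J. finite J \<and> J \<subseteq> F \<and> (\<forall>z\<in>\<Inter>J. r \<le> (norm z)\<^sup>2)}"
  define s where "s = Sup A"
  obtain R where R: "\<And>z. z \<in> B \<Longrightarrow> norm z \<le> R"
    using bdd(2) bounded_iff by blast
  have "r \<le> R\<^sup>2" if r: "r \<in> A" for r
  proof -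
    obtain J where J: "finite J" "J \<subseteq> F" "\<forall>z\<in>\<Inter>J. r \<le> (norm z)\<^sup>2" using r A_def by blast
    obtain z where "z \<in> \<Inter>(insert B J)" using fip[of "insert B J"] J bdd by blast
    then have "r \<le> (norm z)\<^sup>2" "norm z \<le> R" using J R by auto
    then show ?thesis by (meson norm_ge_zero order_trans power_mono)
  qed
  then have bddA: "bdd_above A" by (meson bdd_above.I)
  have A0: "0 \<in> A" unfolding A_def by (auto intro: exI[of _ "{}"])
  define D where "D J \<epsilon> = \<Inter>J \<inter> {z. (norm z)\<^sup>2 \<le> s + \<epsilon>}" for J :: "'h set set" and \<epsilon>
  have D_ne: "D J \<epsilon> \<noteq> {}" if "finite J" "J \<subseteq> F" "\<epsilon> > 0" for J \<epsilon>
  proof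
    assume empty: "D J \<epsilon> = {}"
    have "s + \<epsilon> \<le> (norm z)\<^sup>2" if "z \<in> \<Inter>J" for z
    proof (rule ccontr)
      assume "\<not> s + \<epsilon> \<le> (norm z)\<^sup>2"
      then have "z \<in> D J \<epsilon>" unfolding D_def by (intro IntI CollectI that) simp
      then show False using empty by blast
    qed
    then have "s + \<epsilon> \<in> A"
      unfolding A_def using that(1,2) by (intro CollectI exI[of _ J] conjI ballI)
    then have "s + \<epsilon> \<le> s" unfolding s_def using bddA by (rule cSup_upper)
    then show False using that by simp
  qed
  define \<D> where "\<D> = (\<lambda>(J, \<epsilon>). D J \<epsilon>) ` ({J. finite J \<and> J \<subseteq> F} \<times> {0<..})"
  have "Met_TC.mcomplete TYPE('h)"
    by (simp add: mcomplete_iff_complete complete_UNIV)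
  then have "\<Inter>\<D> \<noteq> {}"
    unfolding Met_TC.mcomplete_fip
  proof (elim allE[of _ \<D>] mp, intro conjI ballI allI impI)
    fix C assume "C \<in> \<D>"
    then obtain J \<epsilon> where J: "J \<subseteq> F" and C: "C = D J \<epsilon>" by (auto simp: \<D>_def)
    have "closed (\<Inter>J)" using J closed by (intro closed_Inter) blast
    moreover have "closed {z :: 'h. (norm z)\<^sup>2 \<le> s + \<epsilon>}"
      by (intro closed_Collect_le continuous_intros)
    ultimately show "closedin Met_TC.mtopology C"
      unfolding C D_def by (simp add: closed_Int)
  next
    fix e :: real assume e: "e > 0"
    \<comment> \<open>Two points of \<open>D J \<epsilon>\<close> have squared norms at most \<open>s + \<epsilon>\<close> and their midpoint at least
      \<open>s - \<epsilon>\<close>, so that their squared distance is at most \<open>4 (s + \<epsilon>) - 4 (s - \<epsilon>) = 8 \<epsilon>\<close>.\<close>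
    define \<epsilon> where "\<epsilon> = e\<^sup>2 / 8"
    have \<epsilon>: "\<epsilon> > 0" using e by (simp add: \<epsilon>_def)
    obtain r where r: "r \<in> A" "s - \<epsilon> < r"
      using less_cSup_iff[of A "s - \<epsilon>"] A0 bddA \<epsilon> by (auto simp: s_def)
    obtain J where J: "finite J" "J \<subseteq> F" "\<forall>z\<in>\<Inter>J. r \<le> (norm z)\<^sup>2"
      using r(1) unfolding A_def by blast
    have low: "s - \<epsilon> \<le> (norm z)\<^sup>2" if "z \<in> \<Inter>J" for z
      using bspec[OF J(3) that] r(2) by simp
    obtain a where a: "a \<in> D J \<epsilon>" using D_ne[OF J(1,2) \<epsilon>] by blast
    have close: "dist a z \<le> e" if z: "z \<in> D J \<epsilon>" for z
    proof -
      have "convex (\<Inter>J)" using conv J by (intro convex_Inter) auto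
      then have "(1/2) *\<^sub>R a + (1/2) *\<^sub>R z \<in> \<Inter>J"
        using a z by (intro convexD) (auto simp: D_def)
      from low[OF this] have "s - \<epsilon> \<le> (norm ((1/2) *\<^sub>R a + (1/2) *\<^sub>R z))\<^sup>2" .
      moreover have "(norm (a - z))\<^sup>2 = 2 * (norm a)\<^sup>2 + 2 * (norm z)\<^sup>2
          - 4 * (norm ((1/2) *\<^sub>R a + (1/2) *\<^sub>R z))\<^sup>2"
        unfolding power2_norm_eq_inner
        by (simp add: inner_diff_left inner_diff_right inner_add_left inner_add_right inner_commute)
      moreover have "(norm a)\<^sup>2 \<le> s + \<epsilon>" "(norm z)\<^sup>2 \<le> s + \<epsilon>" using a z by (auto simp: D_def)
      ultimately have "(norm (a - z))\<^sup>2 \<le> 8 * \<epsilon>" by linarith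
      then have "(norm (a - z))\<^sup>2 \<le> e\<^sup>2" by (simp add: \<epsilon>_def)
      then have "norm (a - z) \<le> e" by (rule power2_le_imp_le) (use e in simp)
      then show ?thesis by (simp add: dist_norm)
    qed
    show "\<exists>C a. C \<in> \<D> \<and> C \<subseteq> Met_TC.mcball a e"
    proof (intro exI conjI)
      show "D J \<epsilon> \<in> \<D>" using J(1,2) \<epsilon> by (auto simp: \<D>_def)
      show "D J \<epsilon> \<subseteq> Met_TC.mcball a e" using close by auto
    qed
  next
    fix \<F> assume \<F>_sub: "finite \<F> \<and> \<F> \<subseteq> \<D>"
    obtain Q where Q: "finite Q" "Q \<subseteq> {J. finite J \<and> J \<subseteq> F} \<times> {0<..}"
      and \<F>: "\<F> = (\<lambda>(J, \<epsilon>). D J \<epsilon>) ` Q"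
      using finite_subset_image[OF conjunct1[OF \<F>_sub] conjunct2[OF \<F>_sub, unfolded \<D>_def]]
      by blast
    define J where "J = \<Union>(fst ` Q)"
    define \<epsilon> where "\<epsilon> = Min (insert 1 (snd ` Q))"
    have mem: "finite J'" "J' \<subseteq> F" "\<epsilon>' > 0" if "(J', \<epsilon>') \<in> Q" for J' \<epsilon>'
      using Q(2) that by auto
    have "finite J" using Q(1) mem(1) by (auto simp: J_def)
    moreover have "J \<subseteq> F" unfolding J_def using mem(2) by force
    moreover have "\<epsilon> > 0" using Q(1) mem(3) by (auto simp: \<epsilon>_def)
    ultimately obtain z where z: "z \<in> D J \<epsilon>" using D_ne[of J \<epsilon>] by blast
    have "z \<in> D J' \<epsilon>'" if "(J', \<epsilon>') \<in> Q" for J' \<epsilon>'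
    proof -
      have "J' \<subseteq> J" using that by (force simp: J_def)
      moreover have "\<epsilon> \<le> \<epsilon>'" using that Q(1) unfolding \<epsilon>_def by (force intro: Min_le)
      ultimately show ?thesis using z by (auto simp: D_def)
    qed
    then show "\<Inter>\<F> \<noteq> {}" unfolding \<F> by blast
  qed
  then obtain z where z: "z \<in> \<Inter>\<D>" by blast
  have "z \<in> C" if "C \<in> F" for C
  proof -
    have "D {C} 1 \<in> \<D>" using that by (auto simp: \<D>_def)
    then show ?thesis using z by (auto simp: D_def)
  qed
  then show ?thesis by blast
qed

section \<open>Kirszbraun's extension theorem\<close>

text \<open>The data are two indexed families rather than a map on a set, so that the index set can
  be the graph of a partial map.\<close>
lemma kirszbraun_one_point:
  fixes x :: "'i \<Rightarrow> 'x::real_inner" and v :: "'i \<Rightarrow> 'h::{real_inner, complete_space}"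
  assumes L: "L \<ge> 0"
    and lip: "\<And>i j. i \<in> I \<Longrightarrow> j \<in> I \<Longrightarrow> norm (v i - v j) \<le> L * norm (x i - x j)"
  shows "\<exists>y. \<forall>i\<in>I. norm (y - v i) \<le> L * norm (x0 - x i)"
proof (cases "I = {}")
  case False
  define C where "C i = cball (v i) (L * norm (x0 - x i))" for i
  have "\<Inter>(C ` I) \<noteq> {}"
  proof -
    obtain i0 where i0: "i0 \<in> I" using False by blast
    show ?thesis
    proof (rule hilbert_closed_convex_fip[where B = "C i0"])
      fix J assume J: "finite J" "J \<subseteq> C ` I"
      obtain I' where I': "I' \<subseteq> I" "finite I'" "J = C ` I'"
        using finite_subset_image[OF J] by blast
      have "\<exists>y. \<forall>i\<in>I'. norm (y - v i) \<le> L * norm (x0 - x i)"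
        using I'(1) by (intro kirszbraun_finite[OF I'(2) L] lip) auto
      then obtain y where "\<forall>i\<in>I'. norm (y - v i) \<le> L * norm (x0 - x i)" ..
      then have "y \<in> \<Inter>J" by (auto simp: I' C_def dist_norm norm_minus_commute)
      then show "\<Inter>J \<noteq> {}" by blast
    qed (use i0 in \<open>auto simp: C_def\<close>)
  qed
  then obtain y where "\<And>i. i \<in> I \<Longrightarrow> y \<in> C i" by blast
  then show ?thesis by (auto simp: C_def dist_norm norm_minus_commute)
qed simp

text \<open>Partial extensions are ordered by inclusion of graphs. A relation that satisfies the
  Lipschitz inequality for all pairs of its elements is single-valued, and a maximal one is
  total because it could otherwise be extended to one more point.\<close>
theorem kirszbraun:
  fixes f :: "'x::real_inner \<Rightarrow> 'h::{real_inner, complete_space}"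
  assumes f: "L-lipschitz_on A f"
  obtains T where "L-lipschitz_on UNIV T" "\<And>x. x \<in> A \<Longrightarrow> T x = f x"
proof -
  have L: "L \<ge> 0" using f by (rule lipschitz_on_nonneg)
  define lip where "lip R \<longleftrightarrow> (\<forall>p\<in>R. \<forall>q\<in>R. norm (snd p - snd q) \<le> L * norm (fst p - fst q))"
    for R :: "('x \<times> 'h) set"
  define \<G> where "\<G> = {R. (\<lambda>x. (x, f x)) ` A \<subseteq> R \<and> lip R}"
  have "\<exists>M\<in>\<G>. \<forall>R\<in>\<G>. M \<subseteq> R \<longrightarrow> R = M"
  proof (rule subset_Zorn_nonempty)
    have "lip ((\<lambda>x. (x, f x)) ` A)"
      unfolding lip_def using lipschitz_onD[OF f] by (clarsimp simp: dist_norm)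
    then have "(\<lambda>x. (x, f x)) ` A \<in> \<G>" by (simp add: \<G>_def)
    then show "\<G> \<noteq> {}" by blast
  next
    fix \<C> assume ne: "\<C> \<noteq> {}" and chain: "subset.chain \<G> \<C>"
    have "lip (\<Union>\<C>)"
      unfolding lip_def
    proof (intro ballI)
      fix p q assume "p \<in> \<Union>\<C>" "q \<in> \<Union>\<C>"
      then obtain R R' where R: "R \<in> \<C>" "p \<in> R" "R' \<in> \<C>" "q \<in> R'" by blast
      then have "R \<subseteq> R' \<or> R' \<subseteq> R" using chain by (simp add: subset_chain_def)
      moreover have "lip R" "lip R'" using R chain by (auto simp: subset_chain_def \<G>_def)
      ultimately show "norm (snd p - snd q) \<le> L * norm (fst p - fst q)"
        using R unfolding lip_def by blast
    qed
    then show "\<Union>\<C> \<in> \<G>"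
      using ne chain unfolding subset_chain_def \<G>_def by blast
  qed
  then obtain M where M: "(\<lambda>x. (x, f x)) ` A \<subseteq> M" "lip M"
    and max: "\<And>R. lip R \<Longrightarrow> M \<subseteq> R \<Longrightarrow> R = M"
    by (auto simp: \<G>_def)
  have total: "\<exists>y. (x, y) \<in> M" for x
  proof -
    have "\<exists>y. \<forall>p\<in>M. norm (y - snd p) \<le> L * norm (x - fst p)"
      using L M(2) unfolding lip_def by (intro kirszbraun_one_point) auto
    then obtain y where y: "\<forall>p\<in>M. norm (y - snd p) \<le> L * norm (x - fst p)" ..
    have "lip (insert (x, y) M)"
      using M(2) y unfolding lip_def by (auto simp: norm_minus_commute)
    then have "insert (x, y) M = M" by (intro max) auto
    then show ?thesis by blast
  qed
  define T where "T x = (SOME y. (x, y) \<in> M)" for x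
  have T: "(x, T x) \<in> M" for x
    unfolding T_def using total by (rule someI_ex)
  show ?thesis
  proof
    show "L-lipschitz_on UNIV T"
      using T M(2) L unfolding lip_def lipschitz_on_def by (force simp: dist_norm)
    show "T x = f x" if "x \<in> A" for x
    proof -
      have "(x, f x) \<in> M" using M(1) that by blast
      then show ?thesis using T[of x] M(2) unfolding lip_def by fastforce
    qed
  qed
qed

section \<open>Lipschitz constants\<close>

lemma Lip_nonneg:
  assumes "Lipschitz_continuous_map m1 m2 f"
  shows "0 \<le> Lip m1 m2 f"
  unfolding Lip_def
  using assms by (intro cInf_greatest) (auto simp: Lipschitz_continuous_map_pos intro: less_imp_le)

lemma Lip_le:
  assumes "0 \<le> L"
    and "\<And>x y. x \<in> mspace m1 \<Longrightarrow> y \<in> mspace m1 \<Longrightarrow> mdist m2 (f x) (f y) \<le> L * mdist m1 x y"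
  shows "Lip m1 m2 f \<le> L"
  unfolding Lip_def using assms by (intro cInf_lower) (auto intro: bdd_belowI[of _ 0])

text \<open>The infimum that defines \<^const>\<open>Lip\<close> is attained for a Lipschitz map, since each pair of points
  imposes a closed condition on the constant.\<close>
lemma Lip_bound:
  assumes f: "Lipschitz_continuous_map m1 m2 f" and xy: "x \<in> mspace m1" "y \<in> mspace m1"
  shows "mdist m2 (f x) (f y) \<le> Lip m1 m2 f * mdist m1 x y"
proof -
  let ?S = "{L. 0 \<le> L \<and> (\<forall>x \<in> mspace m1. \<forall>y \<in> mspace m1. mdist m2 (f x) (f y) \<le> L * mdist m1 x y)}"
  have ne: "?S \<noteq> {}" using f by (auto simp: Lipschitz_continuous_map_pos intro: less_imp_le)
  show ?thesis
  proof (cases "mdist m1 x y = 0")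
    case True
    moreover obtain B where "mdist m2 (f x) (f y) \<le> B * mdist m1 x y"
      using ne xy by blast
    ultimately show ?thesis by simp
  next
    case False
    then have pos: "mdist m1 x y > 0" using mdist_nonneg[of m1 x y] by linarith
    have "mdist m2 (f x) (f y) / mdist m1 x y \<le> Lip m1 m2 f"
      unfolding Lip_def using xy pos by (intro cInf_greatest[OF ne]) (auto simp: pos_divide_le_eq)
    then show ?thesis using pos by (simp add: pos_divide_le_eq)
  qed
qed

section \<open>Factoring Lipschitz maps through the coorbit embedding\<close>

theorem theorem1p7:
  fixes G :: "('g, 'z) monoid_scheme"
    and U :: "'g \<Rightarrow> 'a::euclidean_space \<Rightarrow> 'a"
    and N p :: nat
    and S :: "(nat \<times> nat) set"
    and w :: "nat \<Rightarrow> 'a"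
    and e :: "'m::finite \<Rightarrow> nat \<times> nat"
    and a b :: real
  assumes action: "unitary_action G U"
    and order: "order G = N"
    and dim: "DIM('a) \<ge> 2"
    and S: "S \<subseteq> {1..N} \<times> {1..p}"
    and m: "card S = CARD('m)"
    and e: "bij_betw e UNIV S"
    and upper: "Lipschitz_continuous_map (quotient_metric G U) euclidean_metric
                  (induced_map G U (coorbit_embedding G U w e))"
    and b: "b = Lip (quotient_metric G U) euclidean_metric
                  (induced_map G U (coorbit_embedding G U w e))"
    and a: "a > 0"
    and lower: "\<And>x y. a * mdist (quotient_metric G U) (orbit G U x) (orbit G U y)
                  \<le> norm (coorbit_embedding G U w e x - coorbit_embedding G U w e y)"
  shows "(\<forall>F :: 'a set \<Rightarrow> 'h::{real_inner, complete_space}.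
            Lipschitz_continuous_map (quotient_metric G U) euclidean_metric F \<longrightarrow>
            (\<exists>T :: real ^ 'm \<Rightarrow> 'h.
               Lipschitz_continuous_map euclidean_metric euclidean_metric T \<and>
               (\<forall>x. F (orbit G U x) = T (coorbit_embedding G U w e x)) \<and>
               Lip euclidean_metric euclidean_metric T
                 \<le> 1 / a * Lip (quotient_metric G U) euclidean_metric F))
       \<and> (\<forall>T :: real ^ 'm \<Rightarrow> 'h.
            Lipschitz_continuous_map euclidean_metric euclidean_metric T \<longrightarrow>
            (\<forall>F :: 'a set \<Rightarrow> 'h.
               (\<forall>x. F (orbit G U x) = T (coorbit_embedding G U w e x)) \<longrightarrow>
               Lipschitz_continuous_map (quotient_metric G U) euclidean_metric F \<and>
               Lip (quotient_metric G U) euclidean_metric F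
                 \<le> b * Lip euclidean_metric euclidean_metric T))"
proof (intro conjI allI impI)
  interpret unitary_action G U by (rule action)
  let ?Q = "quotient_metric G U" and ?\<Phi> = "coorbit_embedding G U w e"
  have orbit_in: "orbit G U x \<in> mspace ?Q" for x
    by (auto simp: mspace_quotient_metric orbits_def)
  fix F :: "'a set \<Rightarrow> 'h"
  assume F: "Lipschitz_continuous_map ?Q euclidean_metric F"
  define L where "L = 1 / a * Lip ?Q euclidean_metric F"
  have L: "L \<ge> 0" using Lip_nonneg[OF F] a by (simp add: L_def)
  have key: "norm (F (orbit G U x) - F (orbit G U y)) \<le> L * norm (?\<Phi> x - ?\<Phi> y)" for x y
  proof -
    have "norm (F (orbit G U x) - F (orbit G U y))
        \<le> Lip ?Q euclidean_metric F * mdist ?Q (orbit G U x) (orbit G U y)"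
      using Lip_bound[OF F orbit_in orbit_in] by (simp add: dist_norm)
    also have "\<dots> = L * (a * mdist ?Q (orbit G U x) (orbit G U y))"
      using a by (simp add: L_def)
    also have "\<dots> \<le> L * norm (?\<Phi> x - ?\<Phi> y)"
      using lower L by (rule mult_left_mono)
    finally show ?thesis .
  qed
  \<comment> \<open>By the estimate just shown, the choice of the preimage \<open>x\<close> of \<open>z\<close> does not affect the value.\<close>
  define f where "f z = F (orbit G U (SOME x. ?\<Phi> x = z))" for z
  have f: "f (?\<Phi> x) = F (orbit G U x)" for x
  proof -
    have "?\<Phi> (SOME y. ?\<Phi> y = ?\<Phi> x) = ?\<Phi> x" by (rule someI) simp
    then show ?thesis using key[of "SOME y. ?\<Phi> y = ?\<Phi> x" x] by (simp add: f_def)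
  qed
  have "L-lipschitz_on (range ?\<Phi>) f"
    using key L by (auto simp: lipschitz_on_def dist_norm f)
  then obtain T where T: "L-lipschitz_on UNIV T" "\<And>z. z \<in> range ?\<Phi> \<Longrightarrow> T z = f z"
    using kirszbraun by metis
  have "Lip euclidean_metric euclidean_metric T \<le> L"
    using lipschitz_onD[OF T(1)] L by (intro Lip_le) auto
  then show "\<exists>T :: real ^ 'm \<Rightarrow> 'h.
               Lipschitz_continuous_map euclidean_metric euclidean_metric T \<and>
               (\<forall>x. F (orbit G U x) = T (?\<Phi> x)) \<and>
               Lip euclidean_metric euclidean_metric T \<le> 1 / a * Lip ?Q euclidean_metric F"
    using T f by (intro exI[of _ T]) (auto simp: L_def)
next
  interpret unitary_action G U by (rule action)
  let ?Q = "quotient_metric G U" and ?\<Phi> = "coorbit_embedding G U w e"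
  fix T :: "real ^ 'm \<Rightarrow> 'h" and F :: "'a set \<Rightarrow> 'h"
  assume T: "Lipschitz_continuous_map euclidean_metric euclidean_metric T"
    and FT: "\<forall>x. F (orbit G U x) = T (?\<Phi> x)"
  let ?t = "Lip euclidean_metric euclidean_metric T"
  have bound: "dist (F X) (F Y) \<le> b * ?t * mdist ?Q X Y"
    if XY: "X \<in> mspace ?Q" "Y \<in> mspace ?Q" for X Y
  proof -
    obtain x y where xy: "X = orbit G U x" "Y = orbit G U y"
      using XY by (auto simp: mspace_quotient_metric orbits_def)
    have "dist (F X) (F Y) \<le> ?t * dist (?\<Phi> x) (?\<Phi> y)"
      using Lip_bound[OF T, of "?\<Phi> x" "?\<Phi> y"] by (simp add: FT xy)
    also have "\<dots> \<le> ?t * (b * mdist ?Q X Y)"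
      using Lip_bound[OF upper XY] Lip_nonneg[OF T]
      by (intro mult_left_mono) (simp_all add: b xy induced_coorbit_embedding)
    finally show ?thesis by (simp add: mult_ac)
  qed
  show "Lipschitz_continuous_map ?Q euclidean_metric F"
    unfolding Lipschitz_continuous_map_def using bound by auto
  show "Lip ?Q euclidean_metric F \<le> b * ?t"
    using bound Lip_nonneg[OF T] Lip_nonneg[OF upper] by (intro Lip_le) (auto simp: b)
qed

end
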